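(* Let $q$ be a prime power and let $G$ be a finite $q$-regular bipartite multigraph with bipartition $(U,V)$. Assume that each vertex $v\in V$ is assigned an arbitrary value $\alpha(v)\in\{0,1,\ldots,q-1\}$. If $\mathrm{pm}(G)\not\equiv 0 \pmod q$, then $G$ has a spanning subgraph $H$ such that $d_H(u)=1$ for each vertex $u\in U$, and $d_H(v)\not\equiv \alpha(v) \pmod q$ for each vertex $v\in V$.
   Context: Multigraphs may have multiple (parallel) edges; each parallel edge is a distinct edge. For a vertex $v$ of a multigraph $G$, $d_G(v)$ denotes its degree in $G$, counting multiple edges with multiplicity. $\mathrm{pm}(G)$ denotes the number of perfect matchings of $G$, where a perfect matching is a set of edges covering every vertex exactly once (so matchings using different parallel edges are counted as different). A spanning subgraph $H$ of $G$ has the same vertex set as $G$ and a subset of its edges. *)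

theory Defs
  imports Main "HOL-Number_Theory.Cong" "HOL-Number_Theory.Prime_Powers"
begin

text \<open>Undirected loopless multigraphs. Edges are objects of their own, so parallel edges are
  distinct edges with the same set of end vertices.\<close>

record ('v, 'e) multigraph =
  verts :: "'v set"
  edges :: "'e set"
  ends :: "'e \<Rightarrow> 'v set"

definition wf_multigraph :: "('v, 'e) multigraph \<Rightarrow> bool" where
  "wf_multigraph G \<longleftrightarrow> (\<forall>e\<in>edges G. ends G e \<subseteq> verts G \<and> card (ends G e) = 2)"

definition finite_multigraph :: "('v, 'e) multigraph \<Rightarrow> bool" where
  "finite_multigraph G \<longleftrightarrow> wf_multigraph G \<and> finite (verts G) \<and> finite (edges G)"

definition vertex_degree :: "('v, 'e) multigraph \<Rightarrow> 'v \<Rightarrow> nat" where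
  "vertex_degree G v = card {e \<in> edges G. v \<in> ends G e}"

definition regular_multigraph :: "nat \<Rightarrow> ('v, 'e) multigraph \<Rightarrow> bool" where
  "regular_multigraph k G \<longleftrightarrow> (\<forall>v\<in>verts G. vertex_degree G v = k)"

definition bipartition :: "('v, 'e) multigraph \<Rightarrow> 'v set \<Rightarrow> 'v set \<Rightarrow> bool" where
  "bipartition G U V \<longleftrightarrow> U \<union> V = verts G \<and> U \<inter> V = {} \<and>
     (\<forall>e\<in>edges G. \<exists>u\<in>U. \<exists>v\<in>V. ends G e = {u, v})"

definition perfect_matching :: "('v, 'e) multigraph \<Rightarrow> 'e set \<Rightarrow> bool" where
  "perfect_matching G M \<longleftrightarrow> M \<subseteq> edges G \<and> (\<forall>v\<in>verts G. \<exists>!e. e \<in> M \<and> v \<in> ends G e)"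

definition pm :: "('v, 'e) multigraph \<Rightarrow> nat" where
  "pm G = card {M. perfect_matching G M}"

definition spanning_subgraph :: "('v, 'e) multigraph \<Rightarrow> ('v, 'e) multigraph \<Rightarrow> bool" where
  "spanning_subgraph H G \<longleftrightarrow> verts H = verts G \<and> edges H \<subseteq> edges G \<and>
     (\<forall>e\<in>edges H. ends H e = ends G e)"

end

theory Submission
  imports Defs "HOL-Library.FuncSet"
begin

text \<open>Choosing one edge at every vertex of U gives the spanning subgraphs with all degrees 1 on U.
  Summed over all choices, the product over V of the numbers d(v) - \<alpha>(v) is congruent to pm(G)
  modulo q. Indeed, expand the product. A product of d(v) over a set W smaller than U counts ways to
  attach each vertex of W to a chosen edge; some vertex of U is not involved, its edge is free, and
  so the sum over all choices is divisible by q. Since U and V have the same size, only W = V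
  remains, and there the product of the d(v), whose sum is the size of V, is 1 if all d(v) are 1 and
  0 otherwise. Hence some choice has a product not divisible by q.\<close>

text \<open>Each cardinality is a sum of indicators over \<open>U\<close>, so the product over
  \<open>W\<close> becomes a sum over maps \<open>h\<close> from \<open>W\<close> to
  \<open>U\<close>. After exchanging the sums it suffices to treat one \<open>h\<close>, which
  cannot be onto because \<open>W\<close> is smaller than \<open>U\<close>.\<close>

lemma dvd_sum_PiE_prod_card:
  fixes P :: "'v \<Rightarrow> 'e \<Rightarrow> bool"
  assumes U: "finite U" and A: "\<And>u. u \<in> U \<Longrightarrow> finite (A u)" and W: "finite W"
    and less: "card W < card U" and dvd: "\<And>u. u \<in> U \<Longrightarrow> q dvd card (A u)"
  shows "int q dvd (\<Sum>f\<in>PiE U A. \<Prod>v\<in>W. int (card {u \<in> U. P v (f u)}))"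
proof -
  have free: "int q dvd (\<Sum>f\<in>PiE U A. \<Prod>v\<in>W. of_bool (P v (f (h v))))"
    if h: "h \<in> W \<rightarrow>\<^sub>E U" for h
  proof -
    have hW: "h ` W \<subseteq> U" using h by auto
    have "card (h ` W) < card U" using card_image_le[OF W, of h] less by linarith
    then obtain u0 where u0: "u0 \<in> U" "u0 \<notin> h ` W"
      using hW by (metis less_irrefl subsetI subset_antisym)
    \<comment> \<open>Grouping the factors by the value of \<open>h v\<close> makes the summand a
      product over \<open>u\<close> of terms in \<open>f u\<close> alone, so the sum over
      \<open>f\<close> factors as well.\<close>
    have "(\<Sum>f\<in>PiE U A. \<Prod>v\<in>W. of_bool (P v (f (h v))))
        = (\<Sum>f\<in>PiE U A. \<Prod>u\<in>U. \<Prod>v\<in>{v \<in> W. h v = u}. of_bool (P v (f u)) :: int)"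
    proof (rule sum.cong)
      fix f
      have "(\<Prod>v\<in>W. of_bool (P v (f (h v))))
          = (\<Prod>u\<in>U. \<Prod>v\<in>{v \<in> W. h v = u}. of_bool (P v (f (h v))) :: int)"
        by (rule prod.group[OF W U hW, symmetric])
      then show "(\<Prod>v\<in>W. of_bool (P v (f (h v))))
          = (\<Prod>u\<in>U. \<Prod>v\<in>{v \<in> W. h v = u}. of_bool (P v (f u)) :: int)"
        by simp
    qed simp
    also have "\<dots> = (\<Prod>u\<in>U. \<Sum>e\<in>A u. \<Prod>v\<in>{v \<in> W. h v = u}. of_bool (P v e))"
      by (rule prod_sum_PiE[symmetric]) (use U A in auto)
    also have "int q dvd \<dots>"
    proof -
      \<comment> \<open>At \<open>u0\<close> the inner product is empty, so this factor is just
        \<open>card (A u0)\<close>.\<close>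
      have empty: "{v \<in> W. h v = u0} = {}" using u0 by auto
      have "int q dvd (\<Sum>e\<in>A u0. \<Prod>v\<in>{v \<in> W. h v = u0}. of_bool (P v e))"
        unfolding empty using dvd[OF u0(1)] by simp
      then show ?thesis using U u0(1) by (meson dvd_prodI dvd_trans)
    qed
    finally show ?thesis .
  qed
  have "(\<Sum>f\<in>PiE U A. \<Prod>v\<in>W. int (card {u \<in> U. P v (f u)}))
      = (\<Sum>f\<in>PiE U A. \<Prod>v\<in>W. \<Sum>u\<in>U. of_bool (P v (f u)))"
    using U by (simp add: Collect_conj_eq Int_commute)
  also have "\<dots> = (\<Sum>f\<in>PiE U A. \<Sum>h\<in>W \<rightarrow>\<^sub>E U. \<Prod>v\<in>W. of_bool (P v (f (h v))))"
    by (intro sum.cong refl prod_sum_PiE) (use U W in auto)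
  also have "\<dots> = (\<Sum>h\<in>W \<rightarrow>\<^sub>E U. \<Sum>f\<in>PiE U A. \<Prod>v\<in>W. of_bool (P v (f (h v))))"
    by (rule sum.swap)
  also have "int q dvd \<dots>"
    by (rule dvd_sum) (rule free)
  finally show ?thesis .
qed

text \<open>A zero value makes both sides 0. Otherwise all values are at least 1, and a total equal
  to the number of terms forces equality everywhere.\<close>

lemma prod_eq_of_bool_all_one:
  fixes d :: "'a \<Rightarrow> nat"
  assumes V: "finite V" and sum: "sum d V = card V"
  shows "prod d V = of_bool (\<forall>v\<in>V. d v = 1)"
proof (cases "\<exists>v\<in>V. d v = 0")
  case True
  then show ?thesis using V by (force simp: prod_zero)
next
  case False
  have "d v = 1" if "v \<in> V" for v
    by (rule sum_mono_inv[where f = "\<lambda>_. 1" and g = d, OF _ _ that V, symmetric])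
      (use False sum in \<open>auto simp: Suc_le_eq\<close>)
  then show ?thesis by simp
qed

lemma finite_multigraphD:
  assumes "finite_multigraph G" "bipartition G U V"
  shows "finite U" "finite V" "finite (edges G)"
  using assms finite_Un[of U V] unfolding finite_multigraph_def bipartition_def by simp_all

lemma bipartition_subset_verts:
  assumes "bipartition G U V"
  shows "U \<subseteq> verts G" "V \<subseteq> verts G"
  using assms unfolding bipartition_def by auto

lemma bipartition_card_ends:
  assumes "bipartition G U V" "e \<in> edges G"
  shows "card {u \<in> U. u \<in> ends G e} = 1" "card {v \<in> V. v \<in> ends G e} = 1"
proof -
  obtain u v where uv: "u \<in> U" "v \<in> V" "ends G e = {u, v}" "U \<inter> V = {}"
    using assms unfolding bipartition_def by blast
  then have "{u \<in> U. u \<in> ends G e} = {u}" "{v \<in> V. v \<in> ends G e} = {v}" by auto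
  then show "card {u \<in> U. u \<in> ends G e} = 1" "card {v \<in> V. v \<in> ends G e} = 1" by simp_all
qed

lemma bipartition_ends_unique:
  assumes "bipartition G U V" "e \<in> edges G" "u \<in> U" "u' \<in> U" "u \<in> ends G e" "u' \<in> ends G e"
  shows "u = u'"
proof -
  obtain x where "{u \<in> U. u \<in> ends G e} = {x}"
    using bipartition_card_ends(1)[OF assms(1,2)] by (rule card_1_singletonE)
  then have "u \<in> {x}" "u' \<in> {x}" using assms(3-6) by blast+
  then show ?thesis by simp
qed

text \<open>Double counting: every edge has exactly one end in each class, so
  \<open>q * card U\<close> and \<open>q * card V\<close> both count the edges.\<close>

lemma bipartition_regular_card_eq:
  assumes G: "finite_multigraph G" "regular_multigraph q G" "bipartition G U V" and q: "q > 0"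
  shows "card U = card V"
proof -
  note fin = finite_multigraphD[OF G(1,3)] and sub = bipartition_subset_verts[OF G(3)]
  have "card (edges G) = q * card X"
    if "finite X" "X \<subseteq> verts G" "\<And>e. e \<in> edges G \<Longrightarrow> card {v \<in> X. v \<in> ends G e} = 1" for X
  proof -
    have "\<forall>v\<in>X. card {e \<in> edges G. v \<in> ends G e} = q"
      using G(2) that(2) unfolding regular_multigraph_def vertex_degree_def by auto
    from sum_multicount[OF fin(3) that(1) this] that(3) show ?thesis by simp
  qed
  from this[OF fin(1) sub(1) bipartition_card_ends(1)[OF G(3)]]
    this[OF fin(2) sub(2) bipartition_card_ends(2)[OF G(3)]]
  have "q * card U = q * card V" by linarith
  then show ?thesis using q by simp
qed

text \<open>A product set, so that sums over all choices factor over \<open>U\<close>.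
  Extensionality makes a choice determined by its values on \<open>U\<close>, which keeps the
  counting exact.\<close>

abbreviation edge_choices :: "('v, 'e) multigraph \<Rightarrow> 'v set \<Rightarrow> ('v \<Rightarrow> 'e) set" where
  "edge_choices G U \<equiv> (\<Pi>\<^sub>E u\<in>U. {e \<in> edges G. u \<in> ends G e})"

lemma edge_choicesD:
  assumes "f \<in> edge_choices G U" "u \<in> U"
  shows "f u \<in> edges G" "u \<in> ends G (f u)"
  using PiE_mem[OF assms] by auto

text \<open>An edge has only one end in \<open>U\<close>. The case \<open>f = g\<close> gives
  injectivity of a choice; two different choices are compared when they select the same edge
  set.\<close>

lemma edge_choice_eqD:
  assumes "bipartition G U V" "f \<in> edge_choices G U" "g \<in> edge_choices G U"
    "u \<in> U" "u' \<in> U" "f u = g u'"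
  shows "u = u'"
proof (rule bipartition_ends_unique[OF assms(1)])
  show "f u \<in> edges G" "u \<in> ends G (f u)" using edge_choicesD[OF assms(2,4)] by auto
  show "u' \<in> ends G (f u)" using edge_choicesD[OF assms(3,5)] assms(6) by auto
qed (use assms in auto)

text \<open>Choices at different vertices are different edges, so edges may be counted by the
  vertices that choose them. The right-hand side is the form to which the sum over choices
  applies.\<close>

lemma edge_choice_degree:
  assumes bip: "bipartition G U V" and f: "f \<in> edge_choices G U"
  shows "card {e \<in> f ` U. v \<in> ends G e} = card {u \<in> U. v \<in> ends G (f u)}"
proof -
  have "inj_on f U"
    using edge_choice_eqD[OF bip f f] by (auto intro: inj_onI)
  moreover have "{e \<in> f ` U. v \<in> ends G e} = f ` {u \<in> U. v \<in> ends G (f u)}" by auto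
  ultimately show ?thesis
    by (metis (no_types, lifting) card_image inj_on_subset mem_Collect_eq subsetI)
qed

lemma edge_choice_degree_left:
  assumes bip: "bipartition G U V" and f: "f \<in> edge_choices G U" and u: "u \<in> U"
  shows "card {e \<in> f ` U. u \<in> ends G e} = 1"
proof -
  have "{e \<in> f ` U. u \<in> ends G e} = {f u}"
    using u edge_choicesD[OF f] bipartition_ends_unique[OF bip] by blast
  then show ?thesis by simp
qed

lemma perfect_matching_iff_card:
  "perfect_matching G M \<longleftrightarrow>
     M \<subseteq> edges G \<and> (\<forall>v\<in>verts G. card {e \<in> M. v \<in> ends G e} = 1)"
proof -
  have "(\<exists>!e. e \<in> M \<and> v \<in> ends G e) \<longleftrightarrow> card {e \<in> M. v \<in> ends G e} = 1" for v
    unfolding One_nat_def card_1_singleton_iff set_eq_iff by auto metis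
  then show ?thesis unfolding perfect_matching_def by simp
qed

text \<open>Sending a choice to its set of chosen edges is a bijection onto the perfect matchings.
  Degree 1 on \<open>U\<close> is automatic, so only the condition on \<open>V\<close>
  remains.\<close>

lemma pm_eq_card_edge_choices:
  assumes bip: "bipartition G U V"
  shows "pm G = card {f \<in> edge_choices G U. \<forall>v\<in>V. card {u \<in> U. v \<in> ends G (f u)} = 1}"
    (is "_ = card ?F")
proof -
  have verts: "verts G = U \<union> V" using bip unfolding bipartition_def by auto
  have "bij_betw (\<lambda>f. f ` U) ?F {M. perfect_matching G M}"
  proof (rule bij_betw_imageI)
    show "inj_on (\<lambda>f. f ` U) ?F"
    proof (rule inj_onI)
      fix f g assume fg: "f \<in> ?F" "g \<in> ?F" and img: "f ` U = g ` U"
      show "f = g"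
      proof (rule PiE_ext)
        show f: "f \<in> edge_choices G U" and g: "g \<in> edge_choices G U" using fg by auto
        fix u assume u: "u \<in> U"
        then obtain u' where "u' \<in> U" "f u = g u'" using img by (metis imageE imageI)
        then show "f u = g u" using edge_choice_eqD[OF bip f g u] by metis
      qed
    qed
    show "(\<lambda>f. f ` U) ` ?F = {M. perfect_matching G M}"
    proof (intro equalityI subsetI)
      fix M assume "M \<in> (\<lambda>f. f ` U) ` ?F"
      then obtain f where f: "f \<in> edge_choices G U" "M = f ` U"
        "\<forall>v\<in>V. card {u \<in> U. v \<in> ends G (f u)} = 1" by auto
      then show "M \<in> {M. perfect_matching G M}"
        using edge_choicesD[OF f(1)] edge_choice_degree_left[OF bip f(1)]
          edge_choice_degree[OF bip f(1)]
        by (auto simp: perfect_matching_iff_card verts)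
    next
      fix M assume "M \<in> {M. perfect_matching G M}"
      then have M: "perfect_matching G M" by simp
      \<comment> \<open>The inverse map: each vertex of \<open>U\<close> chooses the edge of
        \<open>M\<close> that covers it.\<close>
      define f where "f = restrict (\<lambda>u. THE e. e \<in> M \<and> u \<in> ends G e) U"
      have fM: "f u \<in> M \<and> u \<in> ends G (f u)" if "u \<in> U" for u
      proof -
        have "\<exists>!e. e \<in> M \<and> u \<in> ends G e"
          using M that verts unfolding perfect_matching_def by auto
        from theI'[OF this] show ?thesis using that by (simp add: f_def)
      qed
      have f: "f \<in> edge_choices G U"
        using fM M unfolding perfect_matching_def by (auto simp: f_def)
      \<comment> \<open>Every edge of \<open>M\<close> has an end in \<open>U\<close> and is by
        uniqueness the edge chosen there.\<close>
      have "M \<subseteq> f ` U"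
      proof
        fix e assume e: "e \<in> M"
        then have "e \<in> edges G" using M unfolding perfect_matching_def by auto
        then obtain u where u: "u \<in> U" "u \<in> ends G e"
          using bip unfolding bipartition_def by (metis insertI1)
        then have "\<exists>!e. e \<in> M \<and> u \<in> ends G e"
          using M verts unfolding perfect_matching_def by auto
        then have "f u = e" using fM[OF u(1)] e u(2) by auto
        then show "e \<in> f ` U" using u by auto
      qed
      then have "M = f ` U" using fM by auto
      then show "M \<in> (\<lambda>f. f ` U) ` ?F"
        using f M edge_choice_degree[OF bip f]
        by (auto simp: perfect_matching_iff_card verts)
    qed
  qed
  from bij_betw_same_card[OF this] show ?thesis unfolding pm_def by (rule sym)
qed

lemma sum_prod_degree_diff_cong_pm:
  fixes \<alpha> :: "'v \<Rightarrow> nat"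
  assumes G: "finite_multigraph G" "regular_multigraph q G" "bipartition G U V" and q: "q > 0"
  shows "[(\<Sum>f\<in>edge_choices G U.
            \<Prod>v\<in>V. int (card {u \<in> U. v \<in> ends G (f u)}) - int (\<alpha> v)) = int (pm G)] (mod int q)"
proof -
  define d where "d = (\<lambda>f v. card {u \<in> U. v \<in> ends G (f u)})"
  define D where "D W = (\<Sum>f\<in>edge_choices G U. \<Prod>v\<in>W. int (d f v))" for W
  note fin = finite_multigraphD[OF G(1,3)] and sub = bipartition_subset_verts(1)[OF G(3)]
  have finC: "finite (edge_choices G U)" using fin by (intro finite_PiE) auto
  have card: "card U = card V" by (rule bipartition_regular_card_eq[OF G q])
  have proper: "int q dvd D W" if "W \<subset> V" for W
    unfolding D_def d_def
  proof (rule dvd_sum_PiE_prod_card)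
    show "finite W" "card W < card U"
      using that fin card by (auto intro: psubset_card_mono finite_subset)
    show "q dvd card {e \<in> edges G. u \<in> ends G e}" if "u \<in> U" for u
      using G(2) sub that unfolding regular_multigraph_def vertex_degree_def by auto
  qed (use fin in auto)
  have "(\<Prod>v\<in>V. d f v) = of_bool (\<forall>v\<in>V. d f v = 1)" if f: "f \<in> edge_choices G U" for f
  proof (rule prod_eq_of_bool_all_one[OF fin(2)])
    \<comment> \<open>Each chosen edge has one end in \<open>V\<close>, so the degrees over
      \<open>V\<close> add up to \<open>card U\<close>, which equals \<open>card V\<close>.\<close>
    have "\<forall>u\<in>U. card {v \<in> V. v \<in> ends G (f u)} = 1"
      using edge_choicesD[OF f] bipartition_card_ends[OF G(3)] by auto
    from sum_multicount[OF fin(2,1) this] show "(\<Sum>v\<in>V. d f v) = card V"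
      by (simp add: d_def card)
  qed
  then have "D V = (\<Sum>f\<in>edge_choices G U. of_bool (\<forall>v\<in>V. d f v = 1))"
    unfolding D_def by (intro sum.cong refl) (simp flip: of_nat_prod)
  also have "\<dots> = int (pm G)"
    using finC by (simp add: pm_eq_card_edge_choices[OF G(3)] d_def Collect_conj_eq)
  finally have full: "D V = int (pm G)" .
  have "(\<Sum>f\<in>edge_choices G U. \<Prod>v\<in>V. int (d f v) - int (\<alpha> v))
      = (\<Sum>f\<in>edge_choices G U. \<Prod>v\<in>V. int (d f v) + - int (\<alpha> v))" by simp
  also have "\<dots> = (\<Sum>f\<in>edge_choices G U. \<Sum>W\<in>Pow V.
        (\<Prod>v\<in>W. int (d f v)) * (\<Prod>v\<in>V - W. - int (\<alpha> v)))"
    by (simp only: prod_add[OF fin(2)])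
  also have "\<dots> = (\<Sum>W\<in>Pow V. D W * (\<Prod>v\<in>V - W. - int (\<alpha> v)))"
    unfolding D_def by (subst sum.swap) (simp only: sum_distrib_right)
  \<comment> \<open>For \<open>W = V\<close> the product over the complement is empty, so this term
    is \<open>D V\<close> itself; all other terms belong to proper subsets and vanish modulo
    \<open>q\<close>.\<close>
  also have "\<dots> = D V + (\<Sum>W\<in>Pow V - {V}. D W * (\<Prod>v\<in>V - W. - int (\<alpha> v)))"
    using fin by (subst sum.remove[of _ V]) auto
  also have "[\<dots> = D V + 0] (mod int q)"
    by (intro cong_add cong_refl)
      (auto simp: cong_0_iff intro!: dvd_sum dvd_mult2 proper)
  finally show ?thesis by (simp add: full d_def)
qed

theorem theorem3:
  fixes G :: "('v, 'e) multigraph" and U V :: "'v set" and q :: nat and \<alpha> :: "'v \<Rightarrow> nat"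
  assumes "primepow q"
    and "finite_multigraph G"
    and "regular_multigraph q G"
    and "bipartition G U V"
    and "\<forall>v\<in>V. \<alpha> v \<in> {0..<q}"
    and "\<not> [pm G = 0] (mod q)"
  shows "\<exists>H. spanning_subgraph H G \<and>
           (\<forall>u\<in>U. vertex_degree H u = 1) \<and>
           (\<forall>v\<in>V. \<not> [vertex_degree H v = \<alpha> v] (mod q))"
proof -
  let ?d = "\<lambda>f v. card {u \<in> U. v \<in> ends G (f u)}"
  have q: "q > 0" using assms(1) primepow_gt_0_nat by blast
  note finV = finite_multigraphD(2)[OF assms(2,4)]
  have "\<not> int q dvd int (pm G)" using assms(6) by (simp add: cong_0_iff)
  then have "\<not> int q dvd (\<Sum>f\<in>edge_choices G U. \<Prod>v\<in>V. int (?d f v) - int (\<alpha> v))"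
    using cong_dvd_iff[OF sum_prod_degree_diff_cong_pm[OF assms(2-4) q]] by simp
  then obtain f where f: "f \<in> edge_choices G U"
    and ndvd: "\<not> int q dvd (\<Prod>v\<in>V. int (?d f v) - int (\<alpha> v))"
    by (meson dvd_sum)
  let ?H = "G\<lparr>edges := f ` U\<rparr>"
  have deg: "vertex_degree ?H v = card {e \<in> f ` U. v \<in> ends G e}" for v
    by (simp add: vertex_degree_def)
  have "spanning_subgraph ?H G"
    using edge_choicesD[OF f] by (auto simp: spanning_subgraph_def)
  moreover have "vertex_degree ?H u = 1" if "u \<in> U" for u
    using edge_choice_degree_left[OF assms(4) f that] by (simp add: deg)
  moreover have "\<not> [vertex_degree ?H v = \<alpha> v] (mod q)" if "v \<in> V" for v
  proof
    assume "[vertex_degree ?H v = \<alpha> v] (mod q)"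
    \<comment> \<open>A single factor divisible by \<open>q\<close> would make the whole product
      divisible, contrary to the choice of \<open>f\<close>.\<close>
    then have "int q dvd int (?d f v) - int (\<alpha> v)"
      by (simp add: deg edge_choice_degree[OF assms(4) f] cong_iff_dvd_diff flip: cong_int_iff)
    then show False using ndvd finV that by (meson dvd_prodI dvd_trans)
  qed
  ultimately show ?thesis by blast
qed

end
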